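(* There is an absolute constant $c>0$ such that the following holds. Let $S\subset\mathbb{Z}$ be a finite set, let $l\ge 2$ be an integer, let $d\neq 0$ be an integer, and let $\varepsilon>0$. Suppose \[ \log|S| \le c\,\frac{\varepsilon\, l}{\log l}. \] Then \[ \mathsf{E}^\times(d\cdot\mathcal{P}^{(l)},S)\le \varepsilon\,|\mathcal{P}^{(l)}|^2|S|. \]
   Context: $\log$ is the logarithm to base $2$. $\mathcal{P}^{(l)}=\{1,\dots,l\}\cap\{\text{primes}\}$, and $d\cdot\mathcal{P}^{(l)}=\{dp : p\in\mathcal{P}^{(l)}\}$. For sets $A,B$ the common multiplicative energy is \[ \mathsf{E}^\times(A,B)=|\{(a_1,a_2,b_1,b_2)\in A\times A\times B\times B : a_1b_1=a_2b_2\}|. \]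
   Formalization: The formal statement additionally assumes 0 ∉ S and |S| ≠ 1; without these the claim is false (S={1}, l=2, d=1, ε=1/2; or S={0,1} with l large and ε = log l/(c l)). *)

theory Defs
  imports Complex_Main "HOL-Computational_Algebra.Primes"
begin

definition primes_upto :: "nat \<Rightarrow> int set" where
  "primes_upto l = {1..int l} \<inter> {p. prime p}"

definition mult_energy :: "'a::times set \<Rightarrow> 'a set \<Rightarrow> nat" where
  "mult_energy A B =
     card {(a1, a2, b1, b2). (a1, a2, b1, b2) \<in> A \<times> A \<times> B \<times> B \<and> a1 * b1 = a2 * b2}"

end

theory Submission imports Defs begin

text \<open>
  Write \<open>P\<close> for the number of primes up to \<open>l\<close>. For a prime \<open>p\<close> and an exponent \<open>k\<close>, split \<open>S\<close> into
  the elements \<open>A\<close> not divisible by \<open>p ^ k\<close> and the elements \<open>B\<close> divisible by it. A solution of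
  \<open>p1 * s1 = p2 * s2\<close> with \<open>s1 \<in> A\<close>, \<open>s2 \<in> B\<close> forces \<open>p1 = p\<close>, so it is determined by \<open>(p2, s1)\<close> as
  well as by \<open>(p2, s2)\<close>; hence there are at most \<open>P * min |A| |B|\<close> of them. Since \<open>x log x\<close> gains
  at least \<open>min a b\<close> when \<open>a\<close> and \<open>b\<close> are merged into \<open>a + b\<close>, induction on \<open>|S|\<close> bounds the energy
  by \<open>P |S| (1 + 2 log |S|)\<close>; when no such splitting is possible, only diagonal solutions exist.

  It remains to use Chebyshev's bound \<open>2 P log l \<ge> l\<close>. By the recurrence of Leibniz' harmonic
  triangle, \<open>(n + 1) * (n choose k)\<close> divides every common multiple \<open>D\<close> of \<open>1, \<dots>, n + 1\<close>. Summing
  over \<open>k\<close> gives \<open>D \<ge> 2 ^ n\<close>, while the least common multiple is at most \<open>(n + 1) ^ \<pi>(n + 1)\<close>.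
\<close>

section \<open>A Chebyshev lower bound for the number of primes\<close>

text \<open>The entries 1 / ((n + 1) * (n choose k)) form Leibniz' harmonic triangle. The absorption
  identities bring all three to the common denominator \<open>M\<close>, where the claim reads k + 1
  = (m + 2) - (m + 1 - k).\<close>

lemma leibniz_triangle_recurrence:
  assumes "k \<le> m"
  shows "1 / (real (m + 2) * real (Suc m choose Suc k)) =
    1 / (real (m + 1) * real (m choose k)) - 1 / (real (m + 2) * real (Suc m choose k))"
proof -
  define c where "c = real (m choose k)"
  have c: "c > 0" using assms by (simp add: c_def)
  have "Suc k * (Suc m choose Suc k) = Suc m * (m choose k)"
    by (rule Suc_times_binomial)
  hence "real (Suc k) * real (Suc m choose Suc k) = real (Suc m) * c"
    unfolding c_def by (metis of_nat_mult)
  hence 1: "real (Suc m choose Suc k) = real (m + 1) * c / real (k + 1)"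
    by (simp add: field_simps)
  have "(Suc m - k) * (Suc m choose k) = Suc m * (m choose k)"
    using binomial_absorb_comp[of "Suc m" k] by simp
  hence "real (Suc m - k) * real (Suc m choose k) = real (Suc m) * c"
    unfolding c_def by (metis of_nat_mult)
  moreover have pos: "real m + 1 - real k > 0" using assms by simp
  moreover have "real (Suc m - k) = real m + 1 - real k" using assms by (simp add: of_nat_diff)
  ultimately have 2: "real (Suc m choose k) = real (m + 1) * c / (real m + 1 - real k)"
    by (simp add: field_simps)
  define M where "M = real (m + 2) * real (m + 1) * c"
  have "1 / (real (m + 2) * real (Suc m choose Suc k)) = real (k + 1) / M"
    unfolding 1 M_def by simp
  also have "\<dots> = real (m + 2) / M - (real m + 1 - real k) / M"
    unfolding diff_divide_distrib[symmetric] by simp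
  also have "real (m + 2) / M = 1 / (real (m + 1) * c)"
    unfolding M_def by simp
  also have "(real m + 1 - real k) / M = 1 / (real (m + 2) * real (Suc m choose k))"
    unfolding 2 M_def by simp
  finally show ?thesis unfolding c_def .
qed

text \<open>Divisibility is recast as integrality of \<open>D\<close> times a triangle entry. Column
  0 has entries 1 / (n + 1), and the recurrence writes each entry of the next column as a difference
  of two entries of the previous one. One of these lies a row higher, so \<open>n\<close> must vary
  in the induction.\<close>

lemma Suc_times_binomial_dvd_common_multiple:
  fixes D :: nat
  assumes "\<And>j. 1 \<le> j \<Longrightarrow> j \<le> Suc n \<Longrightarrow> j dvd D" and "k \<le> n"
  shows "Suc n * (n choose k) dvd D"
proof -
  have "real D / (real (Suc n) * real (n choose k)) \<in> \<int>"
    using assms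
  proof (induction k arbitrary: n)
    case 0
    obtain z where "D = Suc n * z" using "0.prems"(1)[of "Suc n"] by auto
    hence "real D = real (Suc n) * real z" by (metis of_nat_mult)
    hence "real D / (real (Suc n) * real (n choose 0)) = real z" by simp
    thus ?case by (metis Ints_of_nat)
  next
    case (Suc k)
    then obtain m where n: "n = Suc m" by (cases n) auto
    have "real D / (real (Suc m) * real (m choose k)) \<in> \<int>"
      by (rule Suc.IH) (use Suc.prems n in auto)
    moreover have "real D / (real (Suc n) * real (n choose k)) \<in> \<int>"
      by (rule Suc.IH) (use Suc.prems in auto)
    moreover have "real D / (real (Suc n) * real (n choose Suc k)) =
        real D / (real (Suc m) * real (m choose k)) - real D / (real (Suc n) * real (n choose k))"
      using arg_cong[OF leibniz_triangle_recurrence[of k m], of "\<lambda>x. real D * x"] Suc.prems(2)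
      unfolding n by (simp add: right_diff_distrib add.commute)
    ultimately show ?case by simp
  qed
  then obtain z :: int where z: "real D / (real (Suc n) * real (n choose k)) = of_int z"
    by (auto elim: Ints_cases)
  have "real (Suc n) * real (n choose k) \<noteq> 0" using assms(2) by simp
  with z have "real D = of_int z * (real (Suc n) * real (n choose k))"
    by (metis nonzero_eq_divide_eq)
  hence "of_int (int D) = (of_int (z * int (Suc n * (n choose k))) :: real)"
    by (simp only: of_int_mult of_int_of_nat_eq of_nat_mult)
  hence "int D = z * int (Suc n * (n choose k))" by (simp only: of_int_eq_iff)
  hence "int (Suc n * (n choose k)) dvd int D" by simp
  thus ?thesis by (simp only: int_dvd_int_iff)
qed

lemma common_multiple_ge_power2:
  fixes D :: nat
  assumes "\<And>j. 1 \<le> j \<Longrightarrow> j \<le> Suc n \<Longrightarrow> j dvd D" and "D > 0"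
  shows "2 ^ n \<le> D"
proof -
  have "Suc n * 2 ^ n = (\<Sum>k\<le>n. Suc n * (n choose k))"
    by (simp only: sum_distrib_left[symmetric] choose_row_sum)
  also have "\<dots> \<le> (\<Sum>k\<le>n. D)"
    by (rule sum_mono, rule dvd_imp_le[OF Suc_times_binomial_dvd_common_multiple])
       (use assms in auto)
  also have "\<dots> = Suc n * D" by simp
  finally show ?thesis by (simp only: Suc_mult_le_cancel1)
qed

text \<open>The witness is the least common multiple of 1, ..., N: the product over primes p of the
  largest power of p not exceeding N. Each factor is at most N.\<close>

lemma common_multiple_le_power_card_primes:
  fixes N :: nat
  assumes "N \<ge> 1"
  obtains D where "D > 0" "\<And>j. 1 \<le> j \<Longrightarrow> j \<le> N \<Longrightarrow> j dvd D"
    "D \<le> N ^ card {p. prime p \<and> p \<le> N}"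
proof -
  define Q where "Q = {p. prime p \<and> p \<le> N}"
  have finQ: "finite Q" by (auto simp: Q_def)
  define e where "e p = (GREATEST k. p ^ k \<le> N)" for p
  \<comment> \<open>Without a bound on the admissible exponents, \<open>GREATEST\<close> would be
    unspecified.\<close>
  have bnd: "\<forall>k. p ^ k \<le> N \<longrightarrow> k \<le> N" if "p \<in> Q" for p
  proof (intro allI impI)
    fix k assume "p ^ k \<le> N"
    moreover have "k < p ^ k" using that by (intro power_gt_expt) (auto simp: Q_def dest: prime_gt_1_nat)
    ultimately show "k \<le> N" by simp
  qed
  have e_le: "p ^ e p \<le> N" if "p \<in> Q" for p
    unfolding e_def by (rule GreatestI_nat[where k = 0 and b = N]) (use bnd[OF that] assms in simp_all)
  have e_ge: "k \<le> e p" if "p \<in> Q" "p ^ k \<le> N" for p k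
    unfolding e_def by (rule Greatest_le_nat[where b = N]) (use bnd[OF that(1)] that(2) in simp_all)
  define D where "D = (\<Prod>p\<in>Q. p ^ e p)"
  show ?thesis
  proof
    show "D > 0" by (auto simp: D_def Q_def prime_gt_0_nat intro!: prod_pos)
    have "D \<le> (\<Prod>p\<in>Q. N)" unfolding D_def by (intro prod_mono) (auto simp: e_le)
    thus "D \<le> N ^ card {p. prime p \<and> p \<le> N}" by (simp add: Q_def)
    fix j :: nat assume j: "1 \<le> j" "j \<le> N"
    have sub: "prime_factors j \<subseteq> Q"
      using j by (auto simp: Q_def prime_factors_dvd dest: dvd_imp_le)
    have "j = (\<Prod>p\<in>prime_factors j. p ^ multiplicity p j)"
      using j by (intro prime_factorization_nat) auto
    also have "\<dots> dvd (\<Prod>p\<in>prime_factors j. p ^ e p)"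
    proof (intro prod_dvd_prod le_imp_power_dvd)
      fix p assume p: "p \<in> prime_factors j"
      have "p ^ multiplicity p j \<le> j"
        using j by (intro dvd_imp_le multiplicity_dvd) auto
      thus "multiplicity p j \<le> e p" using e_ge p sub j by auto
    qed
    also have "\<dots> dvd D" unfolding D_def by (rule prod_dvd_prod_subset[OF finQ sub])
    finally show "j dvd D" .
  qed
qed

lemma finite_primes_upto: "finite (primes_upto l)"
  by (simp add: primes_upto_def)

lemma card_primes_upto: "card (primes_upto l) = card {p::nat. prime p \<and> p \<le> l}"
proof -
  have "primes_upto l = int ` {p. prime p \<and> p \<le> l}"
  proof (intro set_eqI iffI)
    fix x assume x: "x \<in> primes_upto l"
    hence "x = int (nat x)" by (auto simp: primes_upto_def)
    moreover have "nat x \<in> {p. prime p \<and> p \<le> l}" using x by (auto simp: primes_upto_def)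
    ultimately show "x \<in> int ` {p. prime p \<and> p \<le> l}" by blast
  qed (auto simp: primes_upto_def dest: prime_gt_0_nat)
  thus ?thesis by (simp add: card_image)
qed

lemma card_primes_upto_lower_bound:
  assumes "l \<ge> 2"
  shows "real l \<le> 2 * real (card (primes_upto l)) * log 2 (real l)"
proof -
  obtain D where D: "D > 0" "\<And>j. 1 \<le> j \<Longrightarrow> j \<le> l \<Longrightarrow> j dvd D"
    "D \<le> l ^ card {p. prime p \<and> p \<le> l}"
    using common_multiple_le_power_card_primes[of l] assms by auto
  have "2 ^ (l - 1) \<le> D" using D assms by (intro common_multiple_ge_power2) auto
  hence "2 ^ (l - 1) \<le> l ^ card (primes_upto l)" using D(3) by (simp add: card_primes_upto)
  hence "(2::real) ^ (l - 1) \<le> real l ^ card (primes_upto l)"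
    by (metis of_nat_le_iff of_nat_numeral of_nat_power)
  hence "log 2 ((2::real) ^ (l - 1)) \<le> log 2 (real l ^ card (primes_upto l))"
    using assms by (subst log_le_cancel_iff) auto
  hence "real (l - 1) \<le> real (card (primes_upto l)) * log 2 (real l)"
    using assms by (simp add: log_nat_power)
  \<comment> \<open>The factor 2 comes from l <= 2 * (l - 1), valid for l >= 2.\<close>
  thus ?thesis using assms by (simp add: of_nat_diff)
qed

section \<open>Multiplicative energy of a set of primes\<close>

text \<open>Allowing different sets on the two sides gives names to the off-diagonal blocks that
  appear when S is partitioned.\<close>

definition cross_solutions :: "int set \<Rightarrow> int set \<Rightarrow> int set \<Rightarrow> (int \<times> int \<times> int \<times> int) set" where
  "cross_solutions Q A B =
     {(p, q, s, t). p \<in> Q \<and> q \<in> Q \<and> s \<in> A \<and> t \<in> B \<and> p * s = q * t}"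

lemma finite_cross_solutions:
  assumes "finite Q" "finite A" "finite B"
  shows "finite (cross_solutions Q A B)"
  by (rule finite_subset[of _ "Q \<times> Q \<times> A \<times> B"]) (use assms in \<open>auto simp: cross_solutions_def\<close>)

lemma mult_energy_eq_card_cross_solutions:
  "mult_energy Q S = card (cross_solutions Q S S)"
  unfolding mult_energy_def cross_solutions_def by (rule arg_cong[of _ _ card]) auto

lemma mult_energy_dilate:
  fixes d :: int
  assumes "d \<noteq> 0"
  shows "mult_energy ((\<lambda>p. d * p) ` Q) S = mult_energy Q S"
proof -
  let ?f = "\<lambda>(p, q, s, t). (d * p, d * q, s, t)"
  have "cross_solutions ((\<lambda>p. d * p) ` Q) S S = ?f ` cross_solutions Q S S"
    using assms unfolding cross_solutions_def by (force simp: image_iff mult.assoc)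
  moreover have "inj_on ?f (cross_solutions Q S S)" using assms by (auto simp: inj_on_def)
  ultimately show ?thesis by (simp add: mult_energy_eq_card_cross_solutions card_image)
qed

lemma card_cross_solutions_commute:
  "card (cross_solutions Q A B) = card (cross_solutions Q B A)"
  by (rule bij_betw_same_card[of "\<lambda>(p, q, s, t). (q, p, t, s)"],
      rule bij_betw_byWitness[where f' = "\<lambda>(p, q, s, t). (q, p, t, s)"])
     (auto simp: cross_solutions_def)

lemma mult_energy_union_disjoint:
  assumes "finite Q" "finite A" "finite B" "A \<inter> B = {}"
  shows "mult_energy Q (A \<union> B) =
    mult_energy Q A + mult_energy Q B + 2 * card (cross_solutions Q A B)"
proof -
  note fin = finite_cross_solutions[OF assms(1)]
  have "cross_solutions Q (A \<union> B) (A \<union> B) =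
      (cross_solutions Q A A \<union> cross_solutions Q B B) \<union>
      (cross_solutions Q A B \<union> cross_solutions Q B A)"
    by (auto simp: cross_solutions_def)
  moreover have "card ((cross_solutions Q A A \<union> cross_solutions Q B B) \<union>
      (cross_solutions Q A B \<union> cross_solutions Q B A)) =
      card (cross_solutions Q A A \<union> cross_solutions Q B B) +
      card (cross_solutions Q A B \<union> cross_solutions Q B A)"
    using assms by (intro card_Un_disjoint finite_UnI fin) (auto simp: cross_solutions_def)
  moreover have "card (cross_solutions Q A A \<union> cross_solutions Q B B) =
      card (cross_solutions Q A A) + card (cross_solutions Q B B)"
    using assms by (intro card_Un_disjoint fin) (auto simp: cross_solutions_def)
  moreover have "card (cross_solutions Q A B \<union> cross_solutions Q B A) =
      card (cross_solutions Q A B) + card (cross_solutions Q B A)"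
    using assms by (intro card_Un_disjoint fin) (auto simp: cross_solutions_def)
  ultimately show ?thesis
    by (simp add: mult_energy_eq_card_cross_solutions card_cross_solutions_commute[of Q B A])
qed

lemma card_cross_solutions_prime_power_split:
  assumes Q: "finite Q" "\<And>q. q \<in> Q \<Longrightarrow> prime q" and "prime p"
    and A: "finite A" "\<And>s. s \<in> A \<Longrightarrow> \<not> p ^ k dvd s"
    and B: "finite B" "\<And>s. s \<in> B \<Longrightarrow> p ^ k dvd s"
  shows "card (cross_solutions Q A B) \<le> card Q * min (card A) (card B)"
proof -
  have first: "r = p" if "(r, q, s, t) \<in> cross_solutions Q A B" for r q s t
  proof (rule ccontr)
    assume "r \<noteq> p"
    have *: "r \<in> Q" "s \<in> A" "t \<in> B" "r * s = q * t" using that by (auto simp: cross_solutions_def)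
    have "coprime (p ^ k) r"
      using primes_coprime[OF \<open>prime p\<close> Q(2)[OF *(1)]] \<open>r \<noteq> p\<close> by simp
    moreover have "p ^ k dvd r * s" using B(2)[OF *(3)] *(4) by simp
    ultimately have "p ^ k dvd s" by (simp add: coprime_dvd_mult_right_iff)
    thus False using A(2) * by blast
  qed
  have nz: "q \<noteq> 0" if "q \<in> Q" for q using Q(2)[OF that] by auto
  \<comment> \<open>With the first prime fixed as \<open>p\<close>, the equation p * s = q * t
    recovers t from (q, s), and below s from (q, t).\<close>
  have "card (cross_solutions Q A B) \<le> card (Q \<times> A)"
  proof (rule card_inj_on_le[of "\<lambda>(r, q, s, t). (q, s)"])
    show "inj_on (\<lambda>(r, q, s, t). (q, s)) (cross_solutions Q A B)"
    proof (rule inj_onI, clarsimp)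
      fix r r' q s t t'
      assume h: "(r, q, s, t) \<in> cross_solutions Q A B" "(r', q, s, t') \<in> cross_solutions Q A B"
      have "r = p" "r' = p" using first[OF h(1)] first[OF h(2)] by auto
      moreover have "r * s = q * t" "r' * s = q * t'" "q \<in> Q"
        using h by (auto simp: cross_solutions_def)
      ultimately show "r = r' \<and> t = t'" using nz by auto
    qed
  qed (use Q A in \<open>auto simp: cross_solutions_def\<close>)
  moreover have "card (cross_solutions Q A B) \<le> card (Q \<times> B)"
  proof (rule card_inj_on_le[of "\<lambda>(r, q, s, t). (q, t)"])
    show "inj_on (\<lambda>(r, q, s, t). (q, t)) (cross_solutions Q A B)"
    proof (rule inj_onI, clarsimp)
      fix r r' q s s' t
      assume h: "(r, q, s, t) \<in> cross_solutions Q A B" "(r', q, s', t) \<in> cross_solutions Q A B"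
      have "r = p" "r' = p" using first[OF h(1)] first[OF h(2)] by auto
      moreover have "r * s = q * t" "r' * s' = q * t"
        using h by (auto simp: cross_solutions_def)
      ultimately show "r = r' \<and> s = s'" using not_prime_0 \<open>prime p\<close> by (metis mult_left_cancel)
    qed
  qed (use Q B in \<open>auto simp: cross_solutions_def\<close>)
  ultimately show ?thesis by (simp add: min_def card_cartesian_product)
qed

text \<open>Here all elements of S have the same valuation at each prime of Q, whereas p * s = q * t
  with p and q distinct would make the p-adic valuation of t exceed that of s by one.\<close>

lemma mult_energy_unsplit:
  fixes Q S :: "int set"
  assumes Q: "finite Q" "\<And>q. q \<in> Q \<Longrightarrow> prime q"
    and S: "finite S" "0 \<notin> S"
    and unsplit: "\<And>p k s t. p \<in> Q \<Longrightarrow> s \<in> S \<Longrightarrow> t \<in> S \<Longrightarrow> p ^ k dvd t \<Longrightarrow> p ^ k dvd s"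
  shows "mult_energy Q S \<le> card Q * card S"
proof -
  have diag: "p = q \<and> s = t" if "(p, q, s, t) \<in> cross_solutions Q S S" for p q s t
  proof -
    have *: "p \<in> Q" "q \<in> Q" "s \<in> S" "t \<in> S" "p * s = q * t"
      using that by (auto simp: cross_solutions_def)
    have "p = q"
    proof (rule ccontr)
      assume ne: "p \<noteq> q"
      \<comment> \<open>Divisibility by p ^ k passes from t to s, and the equation returns it to t
        with one more factor p. Infinite divisibility contradicts t being nonzero.\<close>
      have "p ^ k dvd t" for k
      proof (induction k)
        case (Suc k)
        have "p * p ^ k dvd p * s" using unsplit[OF *(1,3,4) Suc] by (rule mult_dvd_mono[OF dvd_refl])
        hence "p ^ Suc k dvd q * t" using * by simp
        moreover have "coprime (p ^ Suc k) q"
          using primes_coprime[OF Q(2)[OF *(1)] Q(2)[OF *(2)] ne] by simp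
        ultimately show ?case by (simp add: coprime_dvd_mult_right_iff del: power_Suc)
      qed simp
      moreover have "t \<noteq> 0" "\<not> is_unit p" using * S Q(2)[of p] by auto
      ultimately show False
        by (metis Suc_n_not_le_n multiplicity_geI)
    qed
    moreover have "p \<noteq> 0" using Q(2)[OF *(1)] by auto
    ultimately show ?thesis using * by auto
  qed
  have "card (cross_solutions Q S S) \<le> card (Q \<times> S)"
  proof (rule card_inj_on_le[of "\<lambda>(p, q, s, t). (p, s)"])
    show "inj_on (\<lambda>(p, q, s, t). (p, s)) (cross_solutions Q S S)"
      by (rule inj_onI, clarsimp) (metis diag)
  qed (use Q S in \<open>auto simp: cross_solutions_def\<close>)
  thus ?thesis by (simp add: mult_energy_eq_card_cross_solutions card_cartesian_product)
qed

text \<open>If a <= b then a + b >= 2 * a, so log (a + b) exceeds log a by at least 1, and this gain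
  is weighted by a.\<close>

lemma xlogx_add_min_le:
  fixes a b :: real
  assumes "a > 0" "b > 0"
  shows "a * log 2 a + b * log 2 b + min a b \<le> (a + b) * log 2 (a + b)"
proof -
  have *: "a * log 2 a + b * log 2 b + a \<le> (a + b) * log 2 (a + b)"
    if "a > 0" "a \<le> b" for a b :: real
  proof -
    have "1 + log 2 a = log 2 (2 * a)" using that by (simp add: log_mult)
    also have "\<dots> \<le> log 2 (a + b)" using that by simp
    finally have "a * (1 + log 2 a) \<le> a * log 2 (a + b)"
      using that by (intro mult_left_mono) auto
    moreover have "b * log 2 b \<le> b * log 2 (a + b)"
      using that by (intro mult_left_mono) auto
    ultimately show ?thesis by (simp add: algebra_simps)
  qed
  show ?thesis using *[of a b] *[of b a] assms by (cases "a \<le> b") (auto simp: add.commute)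
qed

text \<open>The linear term pays for unsplittable sets. The factor 2 on the logarithmic term pays
  for the two off-diagonal blocks created by each split.\<close>

lemma mult_energy_primes_le:
  fixes Q S :: "int set"
  assumes Q: "finite Q" "\<And>q. q \<in> Q \<Longrightarrow> prime q" and S: "finite S" "0 \<notin> S"
  shows "real (mult_energy Q S) \<le>
    real (card Q) * (real (card S) + 2 * (real (card S) * log 2 (real (card S))))"
  using S
proof (induction "card S" arbitrary: S rule: less_induct)
  case less
  show ?case
  proof (cases "\<exists>p k s t. p \<in> Q \<and> s \<in> S \<and> t \<in> S \<and> p ^ k dvd t \<and> \<not> p ^ k dvd s")
    case False
    have "real (mult_energy Q S) \<le> real (card Q * card S)"
      unfolding of_nat_le_iff using False by (intro mult_energy_unsplit Q less.prems) blast+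
    also have "\<dots> \<le> real (card Q) * (real (card S) + 2 * (real (card S) * log 2 (real (card S))))"
    proof (cases "card S = 0")
      case False
      thus ?thesis by (simp add: mult_left_mono)
    qed simp
    finally show ?thesis .
  next
    case True
    then obtain p k s t where h: "p \<in> Q" "s \<in> S" "t \<in> S" "p ^ k dvd t" "\<not> p ^ k dvd s" by blast
    define A where "A = {s \<in> S. \<not> p ^ k dvd s}"
    define B where "B = {s \<in> S. p ^ k dvd s}"
    have SAB: "S = A \<union> B" "A \<inter> B = {}" by (auto simp: A_def B_def)
    have fin: "finite A" "finite B" using less.prems by (auto simp: A_def B_def)
    have "s \<in> A" "t \<in> B" using h by (auto simp: A_def B_def)
    \<comment> \<open>Both parts being nonempty makes each strictly smaller than S, as the induction
      requires.\<close>
    hence pos: "card A > 0" "card B > 0" using fin by (auto simp: card_gt_0_iff)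
    have cS: "card S = card A + card B" using SAB fin by (simp add: card_Un_disjoint)
    define a where "a = real (card A)"
    define b where "b = real (card B)"
    define P where "P = real (card Q)"
    have ab: "a > 0" "b > 0" "P \<ge> 0" using pos by (auto simp: a_def b_def P_def)
    have EA: "real (mult_energy Q A) \<le> P * (a + 2 * (a * log 2 a))"
      unfolding P_def a_def using less.prems cS pos fin by (intro less.hyps) (auto simp: A_def)
    have EB: "real (mult_energy Q B) \<le> P * (b + 2 * (b * log 2 b))"
      unfolding P_def b_def using less.prems cS pos fin by (intro less.hyps) (auto simp: B_def)
    have "card (cross_solutions Q A B) \<le> card Q * min (card A) (card B)"
      using fin Q h by (intro card_cross_solutions_prime_power_split[where p = p and k = k])
        (auto simp: A_def B_def)
    hence "real (card (cross_solutions Q A B)) \<le> real (card Q * min (card A) (card B))"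
      by (simp only: of_nat_le_iff)
    hence EX: "real (card (cross_solutions Q A B)) \<le> P * min a b"
      by (simp add: P_def a_def b_def)
    have "real (mult_energy Q S) = real (mult_energy Q A) + real (mult_energy Q B)
        + 2 * real (card (cross_solutions Q A B))"
      using mult_energy_union_disjoint[OF Q(1) fin SAB(2)] SAB(1) by simp
    also have "\<dots> \<le> P * ((a + b) + 2 * (a * log 2 a + b * log 2 b + min a b))"
      using EA EB EX by (simp add: algebra_simps)
    also have "\<dots> \<le> P * ((a + b) + 2 * ((a + b) * log 2 (a + b)))"
      using xlogx_add_min_le[OF ab(1,2)] ab(3) by (intro mult_left_mono) auto
    finally show ?thesis by (simp add: cS P_def a_def b_def)
  qed
qed

text \<open>The exclusions are genuine. A nonzero singleton has logarithm 0 but energy |P|, too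
  large when epsilon < 1 / |P|; and if 0 is in S, the solutions with both elements 0 already number
  |P|^2.\<close>

theorem theorem12:
  "\<exists>c::real. c > 0 \<and>
     (\<forall>(S::int set) (l::nat) (d::int) (\<epsilon>::real).
        finite S \<longrightarrow> 0 \<notin> S \<longrightarrow> card S \<noteq> 1 \<longrightarrow> l \<ge> 2 \<longrightarrow> d \<noteq> 0 \<longrightarrow> \<epsilon> > 0 \<longrightarrow>
        log 2 (real (card S)) \<le> c * ((\<epsilon> * real l) / log 2 (real l)) \<longrightarrow>
        real (mult_energy ((\<lambda>p. d * p) ` primes_upto l) S)
          \<le> \<epsilon> * (real (card (primes_upto l)))\<^sup>2 * real (card S))"
\<comment> \<open>With c = 1/6, the bound l / log l <= 2 * P yields log n <= epsilon * P / 3. As n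
  >= 2 gives log n >= 1, it follows that 1 + 2 * log n <= 3 * log n <= epsilon * P.\<close>
proof (intro exI[of _ "1/6"] conjI allI impI)
  fix S :: "int set" and l :: nat and d :: int and \<epsilon> :: real
  assume S: "finite S" "0 \<notin> S" "card S \<noteq> 1" and l: "l \<ge> 2" and d: "d \<noteq> 0" and \<epsilon>: "\<epsilon> > 0"
    and le: "log 2 (real (card S)) \<le> 1 / 6 * ((\<epsilon> * real l) / log 2 (real l))"
  define P where "P = real (card (primes_upto l))"
  define n where "n = real (card S)"
  have E: "real (mult_energy ((\<lambda>p. d * p) ` primes_upto l) S) \<le> P * (n + 2 * (n * log 2 n))"
    unfolding mult_energy_dilate[OF d] P_def n_def
    using S finite_primes_upto by (intro mult_energy_primes_le) (auto simp: primes_upto_def)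
  have "P * (n + 2 * (n * log 2 n)) \<le> \<epsilon> * P\<^sup>2 * n"
  proof (cases "card S = 0")
    case False
    hence n: "n \<ge> 2" using S(3) by (simp add: n_def)
    have L: "log 2 (real l) > 0" using l by simp
    have "log 2 n \<ge> 1" using n by simp
    moreover have "real l / log 2 (real l) \<le> 2 * P"
      using card_primes_upto_lower_bound[OF l] L by (simp add: P_def field_simps)
    hence "\<epsilon> * (real l / log 2 (real l)) \<le> \<epsilon> * (2 * P)"
      using \<epsilon> by (intro mult_left_mono) auto
    hence "log 2 n \<le> \<epsilon> * P / 3" using le by (simp add: n_def)
    ultimately have "1 + 2 * log 2 n \<le> \<epsilon> * P" by linarith
    hence "(P * n) * (1 + 2 * log 2 n) \<le> (P * n) * (\<epsilon> * P)"
      using n by (intro mult_left_mono) (auto simp: P_def)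
    thus ?thesis by (simp add: algebra_simps power2_eq_square)
  qed (simp add: n_def)
  with E show "real (mult_energy ((\<lambda>p. d * p) ` primes_upto l) S)
      \<le> \<epsilon> * (real (card (primes_upto l)))\<^sup>2 * real (card S)"
    by (simp add: P_def n_def)
qed simp

end
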